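(* Let $(\mathcal{C},\mathbb{E},\mathfrak{s})$ be an extriangulated category satisfying Condition (WIC), and let $\xi$ be a proper class of $\mathbb{E}$-triangles such that $\mathcal{C}$ has enough $\xi$-projectives and enough $\xi$-injectives. Let $f:A\to A'$ be a morphism in $\mathcal C$, let $\mathbf A:\ \cdots\to G_2\xrightarrow{d_2}G_1\xrightarrow{d_1}G_0\xrightarrow{d_0}A\to0$ be a $\xi$-$\mathcal G$projective resolution of $A$, and let $\mathbf A':\ \cdots\to G'_2\xrightarrow{d'_2}G'_1\xrightarrow{d'_1}G'_0\xrightarrow{d'_0}A'\to0$ be a proper $\xi$-$\mathcal G$projective resolution of $A'$. Then: (1) there exists a chain map $f^\bullet:\mathbf A\to\mathbf A'$ lifting $f$, i.e. morphisms $f_n:G_n\to G'_n$ ($n\geqslant0$) with $d'_0f_0=fd_0$ and $d'_nf_n=f_{n-1}d_n$ for all $n\geqslant1$; (2) the chain map $f^\bullet$ in (1) is unique up to homotopy.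
   Context: Extriangulated category: an additive category $\mathcal C$ with (ET1) a biadditive functor $\mathbb E:\mathcal C^{op}\times\mathcal C\to\mathbf{Ab}$ and a correspondence $\mathfrak s$ sending each $\delta\in\mathbb E(C,A)$ to a class $[A\xrightarrow{x}B\xrightarrow{y}C]$ of sequences modulo isomorphisms that are the identity on $A$ and $C$. Write $a_*\delta=\mathbb E(C,a)(\delta)$, $c^*\delta=\mathbb E(c,A)(\delta)$; a morphism from $\delta\in\mathbb E(C,A)$ to $\delta'\in\mathbb E(C',A')$ is a pair $(a:A\to A',c:C\to C')$ with $a_*\delta=c^*\delta'$. Axioms: (ET2) every morphism $(a,c)$ of extensions is realized by some $b$ making both squares between the realizing sequences commute, $\mathfrak s(0)=[A\to A\oplus C\to C]$, and $\mathfrak s(\delta\oplus\delta')=\mathfrak s(\delta)\oplus\mathfrak s(\delta')$; (ET3) if $\mathfrak s(\delta)=[A\xrightarrow{x}B\xrightarrow{y}C]$, $\mathfrak s(\delta')=[A'\xrightarrow{x'}B'\xrightarrow{y'}C']$ and $bx=x'a$, there is $c$ with $cy=y'b$ and $(a,c):\delta\to\delta'$ a morphism; (ET4) if $\delta\in\mathbb E(D,A)$, $\delta'\in\mathbb E(F,B)$ are realized by $A\xrightarrow{f}B\xrightarrow{f'}D$ and $B\xrightarrow{g}C\xrightarrow{g'}F$, there are an object $E$, $\delta''\in\mathbb E(E,A)$ realized by $A\xrightarrow{gf}C\xrightarrow{h'}E$, and $D\xrightarrow{d}E\xrightarrow{e}F$ realizing $f'_*\delta'$, with $h'g=df'$,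 $eh'=g'$, $d^*\delta''=\delta$, $f_*\delta''=e^*\delta'$; and the duals (ET3)$^{op}$, (ET4)$^{op}$. If $\mathfrak s(\delta)=[A\xrightarrow{x}B\xrightarrow{y}C]$, then $A\xrightarrow{x}B\xrightarrow{y}C\overset{\delta}{\dashrightarrow}$ is called an $\mathbb E$-triangle, $x$ an inflation, $y$ a deflation; it is split if $\delta=0$. Condition (WIC): for composable $f,g$, if $gf$ is an inflation so is $f$; if $gf$ is a deflation so is $g$. Proper class: a class $\xi$ of $\mathbb E$-triangles closed under isomorphisms such that (1) $\xi$ contains the split $\mathbb E$-triangles and is closed under finite coproducts; (2) if $A\to B\to C\overset{\delta}{\dashrightarrow}$ is in $\xi$, so is every $\mathbb E$-triangle realizing $c^*\delta$ or $a_*\delta$, for any $c:C'\to C$, $a:A\to A'$; (3) (saturated) for $\mathbb E$-triangles $A_i\xrightarrow{x_i}B_i\xrightarrow{y_i}C\overset{\delta_i}{\dashrightarrow}$, $i=1,2$, if the second one and the $\mathbb E$-triangle $A_1\to M\to B_2\overset{y_2^*\delta_1}{\dashrightarrow}$ are in $\xi$, then the first one is in $\xi$. $P$ is $\xi$-projective if $0\to\mathcal C(P,A)\to\mathcal C(P,B)\to\mathcal C(P,C)\to0$ is exact for every $\mathbb E$-triangle $A\to B\to C\dashrightarrow$ in $\xi$; $\xi$-injective is dual. $\mathcal P(\xi)$, $\mathcal I(\xi)$ denote the corresponding classes. Enough $\xi$-projectives: each $A$ admits an $\mathbb E$-triangle $K\to P\to A\dashrightarrow$ in $\xi$ with $P\in\mathcal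 P(\xi)$; enough $\xi$-injectives is dual. For a class $\mathcal W$, an $\mathbb E$-triangle $A\to B\to C\dashrightarrow$ in $\xi$ is $\mathcal C(\mathcal W,-)$-exact if $0\to\mathcal C(W,A)\to\mathcal C(W,B)\to\mathcal C(W,C)\to0$ is exact for all $W\in\mathcal W$, and $\mathcal C(-,\mathcal W)$-exact if $0\to\mathcal C(C,W)\to\mathcal C(B,W)\to\mathcal C(A,W)\to0$ is exact for all $W\in\mathcal W$. A complex $\cdots\to X_1\xrightarrow{d_1}X_0\xrightarrow{d_0}X_{-1}\to\cdots$ is $\xi$-exact if there are $\mathbb E$-triangles $K_{n+1}\xrightarrow{g_n}X_n\xrightarrow{f_n}K_n\dashrightarrow$ in $\xi$ (resolution $\mathbb E$-triangles) with $d_n=g_{n-1}f_n$ for all $n$. A complete $\xi$-projective resolution is a $\xi$-exact complex of $\xi$-projectives whose resolution $\mathbb E$-triangles are $\mathcal C(-,\mathcal P(\xi))$-exact; the objects $K_n$ occurring are called $\xi$-$\mathcal G$projective, forming $\mathcal{GP}(\xi)$. A $\xi$-$\mathcal G$projective resolution of $A$ is a $\xi$-exact complex $\cdots\to G_1\to G_0\to A\to0$ with all $G_i\in\mathcal{GP}(\xi)$; it is proper if its resolution $\mathbb E$-triangles $K_{i+1}\to G_i\to K_i\dashrightarrow$ ($K_0=A$) are $\mathcal C(\mathcal{GP}(\xi),-)$-exact. *)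

theory Defs
  imports "HOL-Algebra.Exact_Sequence"
begin

section \<open>Additive categories\<close>

text \<open>
  Sums of morphisms and zero morphisms are written \<open>f \<boxplus> g\<close> and \<open>\<zero>\<^sub>m A B\<close>.  Only values on
  objects in \<open>Obj\<close> and on morphisms in the sets \<open>Hom A B\<close> between such objects are meaningful.
\<close>

record ('o, 'm) cat_data =
  Obj :: "'o set"
  Hom :: "'o \<Rightarrow> 'o \<Rightarrow> 'm set"
  Idn :: "'o \<Rightarrow> 'm" (\<open>\<one>\<^sub>m\<index>\<close>)
  Comp :: "'m \<Rightarrow> 'm \<Rightarrow> 'm" (infixr \<open>\<cdot>\<index>\<close> 75)
  MSum :: "'m \<Rightarrow> 'm \<Rightarrow> 'm" (infixl \<open>\<boxplus>\<index>\<close> 65)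
  MZero :: "'o \<Rightarrow> 'o \<Rightarrow> 'm" (\<open>\<zero>\<^sub>m\<index>\<close>)

definition hom_group :: "('o, 'm, 'z) cat_data_scheme \<Rightarrow> 'o \<Rightarrow> 'o \<Rightarrow> 'm monoid"
  where "hom_group \<C> A B = \<lparr>carrier = Hom \<C> A B, mult = MSum \<C>, one = MZero \<C> A B\<rparr>"

definition hom_diff :: "('o, 'm, 'z) cat_data_scheme \<Rightarrow> 'o \<Rightarrow> 'o \<Rightarrow> 'm \<Rightarrow> 'm \<Rightarrow> 'm"
  where "hom_diff \<C> A B f g = f \<boxplus>\<^bsub>\<C>\<^esub> (inv\<^bsub>hom_group \<C> A B\<^esub> g)"

definition zero_object :: "('o, 'm, 'z) cat_data_scheme \<Rightarrow> 'o \<Rightarrow> bool"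
  where "zero_object \<C> Z \<longleftrightarrow> Z \<in> Obj \<C> \<and>
    (\<forall>A \<in> Obj \<C>. Hom \<C> Z A = {MZero \<C> Z A} \<and> Hom \<C> A Z = {MZero \<C> A Z})"

text \<open>\<open>S\<close> is a biproduct of \<open>A\<close> and \<open>B\<close> with injections \<open>i\<close>, \<open>j\<close> and projections \<open>p\<close>, \<open>q\<close>.\<close>

definition biproduct ::
  "('o, 'm, 'z) cat_data_scheme \<Rightarrow> 'o \<Rightarrow> 'o \<Rightarrow> 'o \<Rightarrow> 'm \<Rightarrow> 'm \<Rightarrow> 'm \<Rightarrow> 'm \<Rightarrow> bool"
  where "biproduct \<C> A B S i j p q \<longleftrightarrow>
    S \<in> Obj \<C> \<and> i \<in> Hom \<C> A S \<and> j \<in> Hom \<C> B S \<and> p \<in> Hom \<C> S A \<and> q \<in> Hom \<C> S B \<and>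
    p \<cdot> i = \<one>\<^sub>m A \<and> q \<cdot> j = \<one>\<^sub>m B \<and> p \<cdot> j = \<zero>\<^sub>m B A \<and> q \<cdot> i = \<zero>\<^sub>m A B \<and>
    (i \<cdot> p) \<boxplus> (j \<cdot> q) = \<one>\<^sub>m S"
  for \<C> (structure)

locale additive_category =
  fixes \<C> :: "('o, 'm, 'z) cat_data_scheme" (structure)
  assumes hom_disjoint:
    "\<lbrakk>A \<in> Obj \<C>; B \<in> Obj \<C>; A' \<in> Obj \<C>; B' \<in> Obj \<C>; f \<in> Hom \<C> A B; f \<in> Hom \<C> A' B'\<rbrakk>
      \<Longrightarrow> A = A' \<and> B = B'"
  and id_in_hom: "A \<in> Obj \<C> \<Longrightarrow> \<one>\<^sub>m A \<in> Hom \<C> A A"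
  and comp_in_hom:
    "\<lbrakk>A \<in> Obj \<C>; B \<in> Obj \<C>; C \<in> Obj \<C>; f \<in> Hom \<C> A B; g \<in> Hom \<C> B C\<rbrakk> \<Longrightarrow> g \<cdot> f \<in> Hom \<C> A C"
  and comp_assoc:
    "\<lbrakk>A \<in> Obj \<C>; B \<in> Obj \<C>; C \<in> Obj \<C>; D \<in> Obj \<C>;
      f \<in> Hom \<C> A B; g \<in> Hom \<C> B C; h \<in> Hom \<C> C D\<rbrakk> \<Longrightarrow> (h \<cdot> g) \<cdot> f = h \<cdot> (g \<cdot> f)"
  and comp_id_left: "\<lbrakk>A \<in> Obj \<C>; B \<in> Obj \<C>; f \<in> Hom \<C> A B\<rbrakk> \<Longrightarrow> \<one>\<^sub>m B \<cdot> f = f"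
  and comp_id_right: "\<lbrakk>A \<in> Obj \<C>; B \<in> Obj \<C>; f \<in> Hom \<C> A B\<rbrakk> \<Longrightarrow> f \<cdot> \<one>\<^sub>m A = f"
  and hom_comm_group: "\<lbrakk>A \<in> Obj \<C>; B \<in> Obj \<C>\<rbrakk> \<Longrightarrow> comm_group (hom_group \<C> A B)"
  and comp_add_left:
    "\<lbrakk>A \<in> Obj \<C>; B \<in> Obj \<C>; C \<in> Obj \<C>; f \<in> Hom \<C> A B; g \<in> Hom \<C> B C; g' \<in> Hom \<C> B C\<rbrakk>
      \<Longrightarrow> (g \<boxplus> g') \<cdot> f = (g \<cdot> f) \<boxplus> (g' \<cdot> f)"
  and comp_add_right:
    "\<lbrakk>A \<in> Obj \<C>; B \<in> Obj \<C>; C \<in> Obj \<C>; f \<in> Hom \<C> A B; f' \<in> Hom \<C> A B; g \<in> Hom \<C> B C\<rbrakk>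
      \<Longrightarrow> g \<cdot> (f \<boxplus> f') = (g \<cdot> f) \<boxplus> (g \<cdot> f')"
  and zero_object_exists: "\<exists>Z. zero_object \<C> Z"
  and biproduct_exists:
    "\<lbrakk>A \<in> Obj \<C>; B \<in> Obj \<C>\<rbrakk> \<Longrightarrow> \<exists>S i j p q. biproduct \<C> A B S i j p q"

definition iso_mor :: "('o, 'm, 'z) cat_data_scheme \<Rightarrow> 'o \<Rightarrow> 'o \<Rightarrow> 'm \<Rightarrow> bool"
  where "iso_mor \<C> A B f \<longleftrightarrow> f \<in> Hom \<C> A B \<and>
    (\<exists>g \<in> Hom \<C> B A. g \<cdot> f = \<one>\<^sub>m A \<and> f \<cdot> g = \<one>\<^sub>m B)"
  for \<C> (structure)

text \<open>\<open>f \<oplus> g\<close>, with \<open>p\<close>, \<open>q\<close> the projections of the source and \<open>i\<close>, \<open>j\<close> the injections of the target.\<close>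

definition mor_dsum ::
  "('o, 'm, 'z) cat_data_scheme \<Rightarrow> 'm \<Rightarrow> 'm \<Rightarrow> 'm \<Rightarrow> 'm \<Rightarrow> 'm \<Rightarrow> 'm \<Rightarrow> 'm"
  where "mor_dsum \<C> i j p q f g = (i \<cdot> f \<cdot> p) \<boxplus> (j \<cdot> g \<cdot> q)"
  for \<C> (structure)

text \<open>Sequences \<open>A \<rightarrow> B \<rightarrow> C\<close> with fixed ends, modulo isomorphisms that are the identity on \<open>A\<close> and \<open>C\<close>.\<close>

definition seqs :: "('o, 'm, 'z) cat_data_scheme \<Rightarrow> 'o \<Rightarrow> 'o \<Rightarrow> ('m \<times> 'm) set"
  where "seqs \<C> A C = {(x, y). \<exists>B \<in> Obj \<C>. x \<in> Hom \<C> A B \<and> y \<in> Hom \<C> B C}"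

definition seq_equiv ::
  "('o, 'm, 'z) cat_data_scheme \<Rightarrow> 'o \<Rightarrow> 'o \<Rightarrow> (('m \<times> 'm) \<times> ('m \<times> 'm)) set"
  where "seq_equiv \<C> A C =
    {((x, y), (x', y')). \<exists>B \<in> Obj \<C>. \<exists>B' \<in> Obj \<C>. \<exists>b.
       x \<in> Hom \<C> A B \<and> y \<in> Hom \<C> B C \<and> x' \<in> Hom \<C> A B' \<and> y' \<in> Hom \<C> B' C \<and>
       iso_mor \<C> B B' b \<and> b \<cdot> x = x' \<and> y' \<cdot> b = y}"
  for \<C> (structure)


section \<open>Extriangulated categories\<close>

text \<open>
  \<open>Ext C A\<close> is \<open>\<bbbE>(C, A)\<close>; \<open>a \<triangleright> \<delta>\<close> and \<open>c \<triangleleft> \<delta>\<close> stand for \<open>a\<^sub>*\<delta>\<close> and \<open>c\<^sup>*\<delta>\<close>;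
  \<open>Rlz \<delta>\<close> is the class \<open>\<ss>(\<delta>)\<close>.
\<close>

record ('o, 'm, 'e) ext_data = "('o, 'm) cat_data" +
  Ext :: "'o \<Rightarrow> 'o \<Rightarrow> 'e set"
  ESum :: "'e \<Rightarrow> 'e \<Rightarrow> 'e" (infixl \<open>\<boxplus>\<^sub>e\<index>\<close> 65)
  EZero :: "'o \<Rightarrow> 'o \<Rightarrow> 'e" (\<open>\<zero>\<^sub>e\<index>\<close>)
  Push :: "'m \<Rightarrow> 'e \<Rightarrow> 'e" (infixr \<open>\<triangleright>\<index>\<close> 75)
  Pull :: "'m \<Rightarrow> 'e \<Rightarrow> 'e" (infixr \<open>\<triangleleft>\<index>\<close> 75)
  Rlz :: "'e \<Rightarrow> ('m \<times> 'm) set"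

definition ext_group :: "('o, 'm, 'e, 'z) ext_data_scheme \<Rightarrow> 'o \<Rightarrow> 'o \<Rightarrow> 'e monoid"
  where "ext_group \<C> C A = \<lparr>carrier = Ext \<C> C A, mult = ESum \<C>, one = EZero \<C> C A\<rparr>"

text \<open>
  \<open>\<delta> \<oplus> \<delta>' \<in> \<bbbE>(C \<oplus> C', A \<oplus> A')\<close>: \<open>i\<close>, \<open>j\<close> are the injections of \<open>A \<oplus> A'\<close> and \<open>p\<close>, \<open>q\<close> the projections
  of \<open>C \<oplus> C'\<close>; under biadditivity this is the element corresponding to \<open>(\<delta>, 0, 0, \<delta>')\<close>.
\<close>

definition ext_dsum ::
  "('o, 'm, 'e, 'z) ext_data_scheme \<Rightarrow> 'm \<Rightarrow> 'm \<Rightarrow> 'm \<Rightarrow> 'm \<Rightarrow> 'e \<Rightarrow> 'e \<Rightarrow> 'e"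
  where "ext_dsum \<C> i j p q \<delta> \<delta>' = (i \<triangleright> p \<triangleleft> \<delta>) \<boxplus>\<^sub>e (j \<triangleright> q \<triangleleft> \<delta>')"
  for \<C> (structure)

definition etriangle ::
  "('o, 'm, 'e, 'z) ext_data_scheme \<Rightarrow> 'o \<Rightarrow> 'm \<Rightarrow> 'o \<Rightarrow> 'm \<Rightarrow> 'o \<Rightarrow> 'e \<Rightarrow> bool"
  where "etriangle \<C> A x B y C \<delta> \<longleftrightarrow>
    A \<in> Obj \<C> \<and> B \<in> Obj \<C> \<and> C \<in> Obj \<C> \<and> x \<in> Hom \<C> A B \<and> y \<in> Hom \<C> B C \<and>
    \<delta> \<in> Ext \<C> C A \<and> (x, y) \<in> Rlz \<C> \<delta>"

locale extriangulated_category = additive_category \<C>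
  for \<C> :: "('o, 'm, 'e, 'z) ext_data_scheme" (structure) +
  \<comment> \<open>(ET1)\<close>
  assumes ext_disjoint:
    "\<lbrakk>A \<in> Obj \<C>; C \<in> Obj \<C>; A' \<in> Obj \<C>; C' \<in> Obj \<C>; \<delta> \<in> Ext \<C> C A; \<delta> \<in> Ext \<C> C' A'\<rbrakk>
      \<Longrightarrow> C = C' \<and> A = A'"
  and ext_comm_group: "\<lbrakk>A \<in> Obj \<C>; C \<in> Obj \<C>\<rbrakk> \<Longrightarrow> comm_group (ext_group \<C> C A)"
  and push_hom:
    "\<lbrakk>A \<in> Obj \<C>; A' \<in> Obj \<C>; C \<in> Obj \<C>; a \<in> Hom \<C> A A'\<rbrakk>
      \<Longrightarrow> (\<lambda>\<delta>. a \<triangleright> \<delta>) \<in> hom (ext_group \<C> C A) (ext_group \<C> C A')"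
  and pull_hom:
    "\<lbrakk>A \<in> Obj \<C>; C \<in> Obj \<C>; C' \<in> Obj \<C>; c \<in> Hom \<C> C' C\<rbrakk>
      \<Longrightarrow> (\<lambda>\<delta>. c \<triangleleft> \<delta>) \<in> hom (ext_group \<C> C A) (ext_group \<C> C' A)"
  and push_id: "\<lbrakk>A \<in> Obj \<C>; C \<in> Obj \<C>; \<delta> \<in> Ext \<C> C A\<rbrakk> \<Longrightarrow> \<one>\<^sub>m A \<triangleright> \<delta> = \<delta>"
  and pull_id: "\<lbrakk>A \<in> Obj \<C>; C \<in> Obj \<C>; \<delta> \<in> Ext \<C> C A\<rbrakk> \<Longrightarrow> \<one>\<^sub>m C \<triangleleft> \<delta> = \<delta>"
  and push_comp:
    "\<lbrakk>A \<in> Obj \<C>; A' \<in> Obj \<C>; A'' \<in> Obj \<C>; C \<in> Obj \<C>; a \<in> Hom \<C> A A'; a' \<in> Hom \<C> A' A'';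
      \<delta> \<in> Ext \<C> C A\<rbrakk> \<Longrightarrow> (a' \<cdot> a) \<triangleright> \<delta> = a' \<triangleright> a \<triangleright> \<delta>"
  and pull_comp:
    "\<lbrakk>A \<in> Obj \<C>; C \<in> Obj \<C>; C' \<in> Obj \<C>; C'' \<in> Obj \<C>; c \<in> Hom \<C> C' C; c' \<in> Hom \<C> C'' C';
      \<delta> \<in> Ext \<C> C A\<rbrakk> \<Longrightarrow> (c \<cdot> c') \<triangleleft> \<delta> = c' \<triangleleft> c \<triangleleft> \<delta>"
  and push_pull:
    "\<lbrakk>A \<in> Obj \<C>; A' \<in> Obj \<C>; C \<in> Obj \<C>; C' \<in> Obj \<C>; a \<in> Hom \<C> A A'; c \<in> Hom \<C> C' C;
      \<delta> \<in> Ext \<C> C A\<rbrakk> \<Longrightarrow> a \<triangleright> c \<triangleleft> \<delta> = c \<triangleleft> a \<triangleright> \<delta>"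
  and push_add:
    "\<lbrakk>A \<in> Obj \<C>; A' \<in> Obj \<C>; C \<in> Obj \<C>; a \<in> Hom \<C> A A'; a' \<in> Hom \<C> A A'; \<delta> \<in> Ext \<C> C A\<rbrakk>
      \<Longrightarrow> (a \<boxplus> a') \<triangleright> \<delta> = (a \<triangleright> \<delta>) \<boxplus>\<^sub>e (a' \<triangleright> \<delta>)"
  and pull_add:
    "\<lbrakk>A \<in> Obj \<C>; C \<in> Obj \<C>; C' \<in> Obj \<C>; c \<in> Hom \<C> C' C; c' \<in> Hom \<C> C' C; \<delta> \<in> Ext \<C> C A\<rbrakk>
      \<Longrightarrow> (c \<boxplus> c') \<triangleleft> \<delta> = (c \<triangleleft> \<delta>) \<boxplus>\<^sub>e (c' \<triangleleft> \<delta>)"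
  and realization_class:
    "\<lbrakk>A \<in> Obj \<C>; C \<in> Obj \<C>; \<delta> \<in> Ext \<C> C A\<rbrakk> \<Longrightarrow> Rlz \<C> \<delta> \<in> seqs \<C> A C // seq_equiv \<C> A C"
  \<comment> \<open>(ET2)\<close>
  and realize_morphism:
    "\<lbrakk>etriangle \<C> A x B y C \<delta>; etriangle \<C> A' x' B' y' C' \<delta>';
      a \<in> Hom \<C> A A'; c \<in> Hom \<C> C C'; a \<triangleright> \<delta> = c \<triangleleft> \<delta>'\<rbrakk>
      \<Longrightarrow> \<exists>b \<in> Hom \<C> B B'. b \<cdot> x = x' \<cdot> a \<and> c \<cdot> y = y' \<cdot> b"
  and realize_zero:
    "\<lbrakk>A \<in> Obj \<C>; C \<in> Obj \<C>; biproduct \<C> A C S i j p q\<rbrakk> \<Longrightarrow> (i, q) \<in> Rlz \<C> (\<zero>\<^sub>e C A)"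
  and realize_dsum:
    "\<lbrakk>etriangle \<C> A x B y C \<delta>; etriangle \<C> A' x' B' y' C' \<delta>';
      biproduct \<C> A A' SA iA jA pA qA; biproduct \<C> B B' SB iB jB pB qB;
      biproduct \<C> C C' SC iC jC pC qC\<rbrakk>
      \<Longrightarrow> (mor_dsum \<C> iB jB pA qA x x', mor_dsum \<C> iC jC pB qB y y')
            \<in> Rlz \<C> (ext_dsum \<C> iA jA pC qC \<delta> \<delta>')"
  \<comment> \<open>(ET3) and its dual\<close>
  and ET3:
    "\<lbrakk>etriangle \<C> A x B y C \<delta>; etriangle \<C> A' x' B' y' C' \<delta>';
      a \<in> Hom \<C> A A'; b \<in> Hom \<C> B B'; b \<cdot> x = x' \<cdot> a\<rbrakk>
      \<Longrightarrow> \<exists>c \<in> Hom \<C> C C'. c \<cdot> y = y' \<cdot> b \<and> a \<triangleright> \<delta> = c \<triangleleft> \<delta>'"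
  and ET3_op:
    "\<lbrakk>etriangle \<C> A x B y C \<delta>; etriangle \<C> A' x' B' y' C' \<delta>';
      b \<in> Hom \<C> B B'; c \<in> Hom \<C> C C'; c \<cdot> y = y' \<cdot> b\<rbrakk>
      \<Longrightarrow> \<exists>a \<in> Hom \<C> A A'. b \<cdot> x = x' \<cdot> a \<and> a \<triangleright> \<delta> = c \<triangleleft> \<delta>'"
  \<comment> \<open>(ET4) and its dual\<close>
  and ET4:
    "\<lbrakk>etriangle \<C> A f B f' D \<delta>; etriangle \<C> B g C g' F \<delta>'\<rbrakk>
      \<Longrightarrow> \<exists>E \<delta>'' h' d e.
            etriangle \<C> A (g \<cdot> f) C h' E \<delta>'' \<and> etriangle \<C> D d E e F (f' \<triangleright> \<delta>') \<and>
            h' \<cdot> g = d \<cdot> f' \<and> e \<cdot> h' = g' \<and> d \<triangleleft> \<delta>'' = \<delta> \<and> f \<triangleright> \<delta>'' = e \<triangleleft> \<delta>'"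
  and ET4_op:
    "\<lbrakk>etriangle \<C> D f' A f B \<delta>; etriangle \<C> F g' B g C \<delta>'\<rbrakk>
      \<Longrightarrow> \<exists>E \<delta>'' h' d e.
            etriangle \<C> E h' A (g \<cdot> f) C \<delta>'' \<and> etriangle \<C> D d E e F (g' \<triangleleft> \<delta>) \<and>
            f \<cdot> h' = g' \<cdot> e \<and> h' \<cdot> d = f' \<and> e \<triangleright> \<delta>'' = \<delta>' \<and> g \<triangleleft> \<delta>'' = d \<triangleright> \<delta>"

definition inflation :: "('o, 'm, 'e, 'z) ext_data_scheme \<Rightarrow> 'm \<Rightarrow> bool"
  where "inflation \<C> x \<longleftrightarrow> (\<exists>A B y C \<delta>. etriangle \<C> A x B y C \<delta>)"

definition deflation :: "('o, 'm, 'e, 'z) ext_data_scheme \<Rightarrow> 'm \<Rightarrow> bool"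
  where "deflation \<C> y \<longleftrightarrow> (\<exists>A x B C \<delta>. etriangle \<C> A x B y C \<delta>)"

definition condition_WIC :: "('o, 'm, 'e, 'z) ext_data_scheme \<Rightarrow> bool"
  where "condition_WIC \<C> \<longleftrightarrow>
    (\<forall>A \<in> Obj \<C>. \<forall>B \<in> Obj \<C>. \<forall>C \<in> Obj \<C>. \<forall>f \<in> Hom \<C> A B. \<forall>g \<in> Hom \<C> B C.
      (inflation \<C> (g \<cdot> f) \<longrightarrow> inflation \<C> f) \<and> (deflation \<C> (g \<cdot> f) \<longrightarrow> deflation \<C> g))"
  for \<C> (structure)


section \<open>Proper classes\<close>

text \<open>
  A class \<open>\<xi>\<close> of \<open>\<bbbE>\<close>-triangles is a set of triples \<open>(x, y, \<delta>)\<close>; the three objects are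
  determined by the disjointness of the hom-sets.
\<close>

definition xi_triangle ::
  "('o, 'm, 'e, 'z) ext_data_scheme \<Rightarrow> ('m \<times> 'm \<times> 'e) set \<Rightarrow>
   'o \<Rightarrow> 'm \<Rightarrow> 'o \<Rightarrow> 'm \<Rightarrow> 'o \<Rightarrow> 'e \<Rightarrow> bool"
  where "xi_triangle \<C> \<xi> A x B y C \<delta> \<longleftrightarrow> etriangle \<C> A x B y C \<delta> \<and> (x, y, \<delta>) \<in> \<xi>"

locale proper_class = extriangulated_category \<C>
  for \<C> :: "('o, 'm, 'e, 'z) ext_data_scheme" (structure) +
  fixes \<xi> :: "('m \<times> 'm \<times> 'e) set"
  assumes xi_etriangles: "(x, y, \<delta>) \<in> \<xi> \<Longrightarrow> \<exists>A B C. etriangle \<C> A x B y C \<delta>"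
  and xi_iso_closed:
    "\<lbrakk>xi_triangle \<C> \<xi> A x B y C \<delta>; etriangle \<C> A' x' B' y' C' \<delta>';
      iso_mor \<C> A A' a; iso_mor \<C> B B' b; iso_mor \<C> C C' c;
      b \<cdot> x = x' \<cdot> a; c \<cdot> y = y' \<cdot> b; a \<triangleright> \<delta> = c \<triangleleft> \<delta>'\<rbrakk> \<Longrightarrow> (x', y', \<delta>') \<in> \<xi>"
  and xi_split: "etriangle \<C> A x B y C (\<zero>\<^sub>e C A) \<Longrightarrow> (x, y, \<zero>\<^sub>e C A) \<in> \<xi>"
  \<comment> \<open>the empty coproduct is a split triangle of zero objects\<close>
  and xi_coproduct:
    "\<lbrakk>xi_triangle \<C> \<xi> A x B y C \<delta>; xi_triangle \<C> \<xi> A' x' B' y' C' \<delta>';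
      biproduct \<C> A A' SA iA jA pA qA; biproduct \<C> B B' SB iB jB pB qB;
      biproduct \<C> C C' SC iC jC pC qC\<rbrakk>
      \<Longrightarrow> (mor_dsum \<C> iB jB pA qA x x', mor_dsum \<C> iC jC pB qB y y',
            ext_dsum \<C> iA jA pC qC \<delta> \<delta>') \<in> \<xi>"
  and xi_base_change:
    "\<lbrakk>xi_triangle \<C> \<xi> A x B y C \<delta>; C' \<in> Obj \<C>; c \<in> Hom \<C> C' C;
      etriangle \<C> A x' B' y' C' (c \<triangleleft> \<delta>)\<rbrakk> \<Longrightarrow> (x', y', c \<triangleleft> \<delta>) \<in> \<xi>"
  and xi_cobase_change:
    "\<lbrakk>xi_triangle \<C> \<xi> A x B y C \<delta>; A' \<in> Obj \<C>; a \<in> Hom \<C> A A';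
      etriangle \<C> A' x' B' y' C (a \<triangleright> \<delta>)\<rbrakk> \<Longrightarrow> (x', y', a \<triangleright> \<delta>) \<in> \<xi>"
  and xi_saturated:
    "\<lbrakk>etriangle \<C> A1 x1 B1 y1 C \<delta>1; xi_triangle \<C> \<xi> A2 x2 B2 y2 C \<delta>2;
      xi_triangle \<C> \<xi> A1 m M m' B2 (y2 \<triangleleft> \<delta>1)\<rbrakk> \<Longrightarrow> (x1, y1, \<delta>1) \<in> \<xi>"


section \<open>Relative projectives, injectives and Gprojectives\<close>

text \<open>
  Exactness of \<open>0 \<rightarrow> \<C>(W, A) \<rightarrow> \<C>(W, B) \<rightarrow> \<C>(W, C) \<rightarrow> 0\<close>, respectively of
  \<open>0 \<rightarrow> \<C>(C, W) \<rightarrow> \<C>(B, W) \<rightarrow> \<C>(A, W) \<rightarrow> 0\<close>.  Beware that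
  \<open>short_exact_sequence\<close> lists groups and maps from right to left.
\<close>

definition hom_from_exact ::
  "('o, 'm, 'z) cat_data_scheme \<Rightarrow> 'o \<Rightarrow> 'o \<Rightarrow> 'm \<Rightarrow> 'o \<Rightarrow> 'm \<Rightarrow> 'o \<Rightarrow> bool"
  where "hom_from_exact \<C> W A x B y C \<longleftrightarrow>
    short_exact_sequence (hom_group \<C> W C) (hom_group \<C> W B) (hom_group \<C> W A)
      (\<lambda>h. y \<cdot> h) (\<lambda>h. x \<cdot> h)"
  for \<C> (structure)

definition hom_into_exact ::
  "('o, 'm, 'z) cat_data_scheme \<Rightarrow> 'o \<Rightarrow> 'o \<Rightarrow> 'm \<Rightarrow> 'o \<Rightarrow> 'm \<Rightarrow> 'o \<Rightarrow> bool"
  where "hom_into_exact \<C> W A x B y C \<longleftrightarrow>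
    short_exact_sequence (hom_group \<C> A W) (hom_group \<C> B W) (hom_group \<C> C W)
      (\<lambda>h. h \<cdot> x) (\<lambda>h. h \<cdot> y)"
  for \<C> (structure)

definition xi_projectives :: "('o, 'm, 'e, 'z) ext_data_scheme \<Rightarrow> ('m \<times> 'm \<times> 'e) set \<Rightarrow> 'o set"
  where "xi_projectives \<C> \<xi> =
    {P \<in> Obj \<C>. \<forall>A x B y C \<delta>. xi_triangle \<C> \<xi> A x B y C \<delta> \<longrightarrow> hom_from_exact \<C> P A x B y C}"

definition xi_injectives :: "('o, 'm, 'e, 'z) ext_data_scheme \<Rightarrow> ('m \<times> 'm \<times> 'e) set \<Rightarrow> 'o set"
  where "xi_injectives \<C> \<xi> =
    {I \<in> Obj \<C>. \<forall>A x B y C \<delta>. xi_triangle \<C> \<xi> A x B y C \<delta> \<longrightarrow> hom_into_exact \<C> I A x B y C}"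

definition enough_xi_projectives ::
  "('o, 'm, 'e, 'z) ext_data_scheme \<Rightarrow> ('m \<times> 'm \<times> 'e) set \<Rightarrow> bool"
  where "enough_xi_projectives \<C> \<xi> \<longleftrightarrow>
    (\<forall>A \<in> Obj \<C>. \<exists>P \<in> xi_projectives \<C> \<xi>. \<exists>K x y \<delta>. xi_triangle \<C> \<xi> K x P y A \<delta>)"

definition enough_xi_injectives ::
  "('o, 'm, 'e, 'z) ext_data_scheme \<Rightarrow> ('m \<times> 'm \<times> 'e) set \<Rightarrow> bool"
  where "enough_xi_injectives \<C> \<xi> \<longleftrightarrow>
    (\<forall>A \<in> Obj \<C>. \<exists>I \<in> xi_injectives \<C> \<xi>. \<exists>K x y \<delta>. xi_triangle \<C> \<xi> A x I y K \<delta>)"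

text \<open>\<open>d n : X n \<rightarrow> X (n - 1)\<close>\<close>

definition chain_complex ::
  "('o, 'm, 'z) cat_data_scheme \<Rightarrow> (int \<Rightarrow> 'o) \<Rightarrow> (int \<Rightarrow> 'm) \<Rightarrow> bool"
  where "chain_complex \<C> X d \<longleftrightarrow>
    (\<forall>n. X n \<in> Obj \<C> \<and> d n \<in> Hom \<C> (X n) (X (n - 1)) \<and>
         d n \<cdot> d (n + 1) = \<zero>\<^sub>m (X (n + 1)) (X (n - 1)))"
  for \<C> (structure)

text \<open>The complex \<open>X\<close> is \<open>\<xi>\<close>-exact with resolution triangles \<open>K (n + 1) \<rightarrow> X n \<rightarrow> K n\<close>.\<close>

definition xi_exact_complex ::
  "('o, 'm, 'e, 'z) ext_data_scheme \<Rightarrow> ('m \<times> 'm \<times> 'e) set \<Rightarrow> (int \<Rightarrow> 'o) \<Rightarrow> (int \<Rightarrow> 'm) \<Rightarrow>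
   (int \<Rightarrow> 'o) \<Rightarrow> (int \<Rightarrow> 'm) \<Rightarrow> (int \<Rightarrow> 'm) \<Rightarrow> (int \<Rightarrow> 'e) \<Rightarrow> bool"
  where "xi_exact_complex \<C> \<xi> X d K g f \<delta> \<longleftrightarrow>
    chain_complex \<C> X d \<and>
    (\<forall>n. xi_triangle \<C> \<xi> (K (n + 1)) (g n) (X n) (f n) (K n) (\<delta> n) \<and> d n = g (n - 1) \<cdot> f n)"
  for \<C> (structure)

definition complete_xi_projective_resolution ::
  "('o, 'm, 'e, 'z) ext_data_scheme \<Rightarrow> ('m \<times> 'm \<times> 'e) set \<Rightarrow> (int \<Rightarrow> 'o) \<Rightarrow> (int \<Rightarrow> 'm) \<Rightarrow>
   (int \<Rightarrow> 'o) \<Rightarrow> (int \<Rightarrow> 'm) \<Rightarrow> (int \<Rightarrow> 'm) \<Rightarrow> (int \<Rightarrow> 'e) \<Rightarrow> bool"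
  where "complete_xi_projective_resolution \<C> \<xi> X d K g f \<delta> \<longleftrightarrow>
    xi_exact_complex \<C> \<xi> X d K g f \<delta> \<and> (\<forall>n. X n \<in> xi_projectives \<C> \<xi>) \<and>
    (\<forall>n. \<forall>W \<in> xi_projectives \<C> \<xi>. hom_into_exact \<C> W (K (n + 1)) (g n) (X n) (f n) (K n))"

definition xi_Gprojectives :: "('o, 'm, 'e, 'z) ext_data_scheme \<Rightarrow> ('m \<times> 'm \<times> 'e) set \<Rightarrow> 'o set"
  where "xi_Gprojectives \<C> \<xi> =
    {M. \<exists>X d K g f \<delta> n. complete_xi_projective_resolution \<C> \<xi> X d K g f \<delta> \<and> M = K n}"


section \<open>Gprojective resolutions, chain maps and homotopies\<close>

text \<open>
  The complex \<open>\<dots> \<rightarrow> G 1 \<rightarrow> G 0 \<rightarrow> A \<rightarrow> 0\<close>, where \<open>d 0 : G 0 \<rightarrow> A\<close> and \<open>d (n + 1) : G (n + 1) \<rightarrow> G n\<close>.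
\<close>

definition augmented_complex ::
  "('o, 'm, 'z) cat_data_scheme \<Rightarrow> 'o \<Rightarrow> (nat \<Rightarrow> 'o) \<Rightarrow> (nat \<Rightarrow> 'm) \<Rightarrow> bool"
  where "augmented_complex \<C> A G d \<longleftrightarrow>
    A \<in> Obj \<C> \<and> (\<forall>n. G n \<in> Obj \<C>) \<and>
    d 0 \<in> Hom \<C> (G 0) A \<and> (\<forall>n. d (Suc n) \<in> Hom \<C> (G (Suc n)) (G n)) \<and>
    d 0 \<cdot> d 1 = \<zero>\<^sub>m (G 1) A \<and>
    (\<forall>n. d (Suc n) \<cdot> d (Suc (Suc n)) = \<zero>\<^sub>m (G (Suc (Suc n))) (G n))"
  for \<C> (structure)

text \<open>
  As \<open>K 0 = A\<close>, the factorization \<open>d n = g (n - 1) \<cdot> f n\<close> reads \<open>d 0 = f 0\<close> in degree zero.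
\<close>

definition resolution_triangles ::
  "('o, 'm, 'e, 'z) ext_data_scheme \<Rightarrow> ('m \<times> 'm \<times> 'e) set \<Rightarrow> 'o \<Rightarrow> (nat \<Rightarrow> 'o) \<Rightarrow> (nat \<Rightarrow> 'm) \<Rightarrow>
   (nat \<Rightarrow> 'o) \<Rightarrow> (nat \<Rightarrow> 'm) \<Rightarrow> (nat \<Rightarrow> 'm) \<Rightarrow> (nat \<Rightarrow> 'e) \<Rightarrow> bool"
  where "resolution_triangles \<C> \<xi> A G d K g f \<delta> \<longleftrightarrow>
    K 0 = A \<and> (\<forall>n. xi_triangle \<C> \<xi> (K (Suc n)) (g n) (G n) (f n) (K n) (\<delta> n)) \<and>
    d 0 = f 0 \<and> (\<forall>n. d (Suc n) = g n \<cdot> f (Suc n))"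
  for \<C> (structure)

definition xi_Gprojective_resolution ::
  "('o, 'm, 'e, 'z) ext_data_scheme \<Rightarrow> ('m \<times> 'm \<times> 'e) set \<Rightarrow> 'o \<Rightarrow> (nat \<Rightarrow> 'o) \<Rightarrow> (nat \<Rightarrow> 'm) \<Rightarrow> bool"
  where "xi_Gprojective_resolution \<C> \<xi> A G d \<longleftrightarrow>
    augmented_complex \<C> A G d \<and> (\<forall>n. G n \<in> xi_Gprojectives \<C> \<xi>) \<and>
    (\<exists>K g f \<delta>. resolution_triangles \<C> \<xi> A G d K g f \<delta>)"

definition proper_xi_Gprojective_resolution ::
  "('o, 'm, 'e, 'z) ext_data_scheme \<Rightarrow> ('m \<times> 'm \<times> 'e) set \<Rightarrow> 'o \<Rightarrow> (nat \<Rightarrow> 'o) \<Rightarrow> (nat \<Rightarrow> 'm) \<Rightarrow> bool"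
  where "proper_xi_Gprojective_resolution \<C> \<xi> A G d \<longleftrightarrow>
    augmented_complex \<C> A G d \<and> (\<forall>n. G n \<in> xi_Gprojectives \<C> \<xi>) \<and>
    (\<exists>K g f \<delta>. resolution_triangles \<C> \<xi> A G d K g f \<delta> \<and>
      (\<forall>n. \<forall>W \<in> xi_Gprojectives \<C> \<xi>. hom_from_exact \<C> W (K (Suc n)) (g n) (G n) (f n) (K n)))"

definition chain_map_lifting ::
  "('o, 'm, 'z) cat_data_scheme \<Rightarrow> 'm \<Rightarrow> (nat \<Rightarrow> 'o) \<Rightarrow> (nat \<Rightarrow> 'm) \<Rightarrow> (nat \<Rightarrow> 'o) \<Rightarrow> (nat \<Rightarrow> 'm) \<Rightarrow>
   (nat \<Rightarrow> 'm) \<Rightarrow> bool"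
  where "chain_map_lifting \<C> f G d G' d' \<phi> \<longleftrightarrow>
    (\<forall>n. \<phi> n \<in> Hom \<C> (G n) (G' n)) \<and>
    d' 0 \<cdot> \<phi> 0 = f \<cdot> d 0 \<and> (\<forall>n. d' (Suc n) \<cdot> \<phi> (Suc n) = \<phi> n \<cdot> d (Suc n))"
  for \<C> (structure)

text \<open>
  A homotopy has components \<open>s n : G n \<rightarrow> G' (n + 1)\<close> for \<open>n \<ge> 0\<close>; the component \<open>A \<rightarrow> G' 0\<close> is
  zero, so this is at once a homotopy of the augmented and of the deleted complexes.
\<close>

definition chain_homotopic ::
  "('o, 'm, 'z) cat_data_scheme \<Rightarrow> (nat \<Rightarrow> 'o) \<Rightarrow> (nat \<Rightarrow> 'm) \<Rightarrow> (nat \<Rightarrow> 'o) \<Rightarrow> (nat \<Rightarrow> 'm) \<Rightarrow>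
   (nat \<Rightarrow> 'm) \<Rightarrow> (nat \<Rightarrow> 'm) \<Rightarrow> bool"
  where "chain_homotopic \<C> G d G' d' \<phi> \<psi> \<longleftrightarrow>
    (\<exists>s. (\<forall>n. s n \<in> Hom \<C> (G n) (G' (Suc n))) \<and>
      hom_diff \<C> (G 0) (G' 0) (\<phi> 0) (\<psi> 0) = d' 1 \<cdot> s 0 \<and>
      (\<forall>n. hom_diff \<C> (G (Suc n)) (G' (Suc n)) (\<phi> (Suc n)) (\<psi> (Suc n)) =
             (d' (Suc (Suc n)) \<cdot> s (Suc n)) \<boxplus> (s n \<cdot> d (Suc n))))"
  for \<C> (structure)

end

theory Submission
  imports Defs
begin

text \<open>
  The proof is the comparison theorem of homological algebra.  Exactness of \<open>\<C>(W, -)\<close> on the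
  resolution triangles of the proper resolution splices to exactness of \<open>\<C>(W, -)\<close> on the augmented
  complex, for every Gprojective \<open>W\<close>.  Chain map and homotopy are then built degree by degree; of
  the first resolution only \<open>d\<^sup>2 = 0\<close> and the Gprojectivity of its terms matter.
\<close>

section \<open>Additive structure of the morphism groups\<close>

context additive_category
begin

lemma MZero_in_Hom: "\<lbrakk>A \<in> Obj \<C>; B \<in> Obj \<C>\<rbrakk> \<Longrightarrow> \<zero>\<^sub>m A B \<in> Hom \<C> A B"
  using monoid.one_closed[OF comm_group.axioms(1)[OF hom_comm_group, THEN comm_monoid.axioms(1)], of A B]
  by (simp add: hom_group_def)

lemma MSum_in_Hom:
  assumes "A \<in> Obj \<C>" "B \<in> Obj \<C>" "f \<in> Hom \<C> A B" "g \<in> Hom \<C> A B"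
  shows "f \<boxplus> g \<in> Hom \<C> A B"
proof -
  interpret H: comm_group "hom_group \<C> A B" using assms by (intro hom_comm_group)
  show ?thesis using H.m_closed[of f g] assms by (simp add: hom_group_def)
qed

lemma MSum_zero_left:
  assumes "A \<in> Obj \<C>" "B \<in> Obj \<C>" "f \<in> Hom \<C> A B"
  shows "\<zero>\<^sub>m A B \<boxplus> f = f"
proof -
  interpret H: comm_group "hom_group \<C> A B" using assms by (intro hom_comm_group)
  show ?thesis using H.l_one[of f] assms by (simp add: hom_group_def)
qed

lemma MSum_zero_right:
  assumes "A \<in> Obj \<C>" "B \<in> Obj \<C>" "f \<in> Hom \<C> A B"
  shows "f \<boxplus> \<zero>\<^sub>m A B = f"
proof -
  interpret H: comm_group "hom_group \<C> A B" using assms by (intro hom_comm_group)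
  show ?thesis using H.r_one[of f] assms by (simp add: hom_group_def)
qed

lemma MSum_right_cancel:
  assumes "A \<in> Obj \<C>" "B \<in> Obj \<C>" "f \<in> Hom \<C> A B" "g \<in> Hom \<C> A B" "h \<in> Hom \<C> A B"
  shows "f \<boxplus> h = g \<boxplus> h \<longleftrightarrow> f = g"
proof -
  interpret H: comm_group "hom_group \<C> A B" using assms by (intro hom_comm_group)
  show ?thesis using H.right_cancel[of h f g] assms by (auto simp: hom_group_def)
qed

section \<open>Differences of morphisms\<close>

lemma hom_diff_in_Hom:
  assumes "A \<in> Obj \<C>" "B \<in> Obj \<C>" "f \<in> Hom \<C> A B" "g \<in> Hom \<C> A B"
  shows "hom_diff \<C> A B f g \<in> Hom \<C> A B"
proof -
  interpret H: comm_group "hom_group \<C> A B" using assms by (intro hom_comm_group)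
  show ?thesis using H.m_closed[of f "inv\<^bsub>hom_group \<C> A B\<^esub> g"] H.inv_closed[of g] assms
    by (simp add: hom_diff_def hom_group_def)
qed

lemma hom_diff_add_cancel:
  assumes "A \<in> Obj \<C>" "B \<in> Obj \<C>" "f \<in> Hom \<C> A B" "g \<in> Hom \<C> A B"
  shows "hom_diff \<C> A B f g \<boxplus> g = f"
proof -
  interpret H: comm_group "hom_group \<C> A B" using assms by (intro hom_comm_group)
  have "f \<in> carrier (hom_group \<C> A B)" "g \<in> carrier (hom_group \<C> A B)"
    using assms by (simp_all add: hom_group_def)
  then have "f \<otimes>\<^bsub>hom_group \<C> A B\<^esub> inv\<^bsub>hom_group \<C> A B\<^esub> g \<otimes>\<^bsub>hom_group \<C> A B\<^esub> g = f"
    by (simp add: H.m_assoc)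
  then show ?thesis by (simp add: hom_diff_def hom_group_def)
qed

text \<open>The biadditivity axioms speak of sums only, so equations between differences are moved
  to sums and back. Right cancellation of \<open>g\<close> makes the passage reversible.\<close>

lemma hom_diff_eq_iff:
  assumes "A \<in> Obj \<C>" "B \<in> Obj \<C>" "f \<in> Hom \<C> A B" "g \<in> Hom \<C> A B" "h \<in> Hom \<C> A B"
  shows "hom_diff \<C> A B f g = h \<longleftrightarrow> f = h \<boxplus> g"
  using assms by (metis MSum_right_cancel hom_diff_add_cancel hom_diff_in_Hom)

section \<open>Composition with zero morphisms and with differences\<close>

lemma comp_zero_left:
  assumes "A \<in> Obj \<C>" "B \<in> Obj \<C>" "C \<in> Obj \<C>" "f \<in> Hom \<C> A B"
  shows "\<zero>\<^sub>m B C \<cdot> f = \<zero>\<^sub>m A C"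
proof -
  let ?z = "\<zero>\<^sub>m B C"
  have z: "?z \<cdot> f \<in> Hom \<C> A C"
    using assms by (intro comp_in_hom[of A B C] MZero_in_Hom)
  \<comment> \<open>Zero is idempotent under addition, so the composite equals its own double;
    cancellation in the group then makes it vanish.\<close>
  have "(?z \<cdot> f) \<boxplus> (?z \<cdot> f) = (?z \<boxplus> ?z) \<cdot> f"
    using assms by (intro comp_add_left[of A B C, symmetric] MZero_in_Hom)
  also have "\<dots> = \<zero>\<^sub>m A C \<boxplus> (?z \<cdot> f)"
    using assms z by (simp add: MSum_zero_left MZero_in_Hom)
  finally show ?thesis
    using assms z by (simp add: MSum_right_cancel MZero_in_Hom)
qed

lemma comp_zero_right:
  assumes "A \<in> Obj \<C>" "B \<in> Obj \<C>" "C \<in> Obj \<C>" "g \<in> Hom \<C> B C"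
  shows "g \<cdot> \<zero>\<^sub>m A B = \<zero>\<^sub>m A C"
proof -
  let ?z = "\<zero>\<^sub>m A B"
  have z: "g \<cdot> ?z \<in> Hom \<C> A C"
    using assms by (intro comp_in_hom[of A B C] MZero_in_Hom)
  have "(g \<cdot> ?z) \<boxplus> (g \<cdot> ?z) = g \<cdot> (?z \<boxplus> ?z)"
    using assms by (intro comp_add_right[of A B C, symmetric] MZero_in_Hom)
  also have "\<dots> = \<zero>\<^sub>m A C \<boxplus> (g \<cdot> ?z)"
    using assms z by (simp add: MSum_zero_left MZero_in_Hom)
  finally show ?thesis
    using assms z by (simp add: MSum_right_cancel MZero_in_Hom)
qed

lemma comp_hom_diff_right:
  assumes "A \<in> Obj \<C>" "B \<in> Obj \<C>" "C \<in> Obj \<C>"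
    and "f \<in> Hom \<C> A B" "f' \<in> Hom \<C> A B" "g \<in> Hom \<C> B C"
  shows "g \<cdot> hom_diff \<C> A B f f' = hom_diff \<C> A C (g \<cdot> f) (g \<cdot> f')"
proof -
  let ?D = "hom_diff \<C> A B f f'"
  have D: "?D \<in> Hom \<C> A B" using assms by (intro hom_diff_in_Hom)
  have "g \<cdot> f = g \<cdot> (?D \<boxplus> f')"
    using assms by (simp add: hom_diff_add_cancel)
  also have "\<dots> = (g \<cdot> ?D) \<boxplus> (g \<cdot> f')"
    using assms D by (intro comp_add_right)
  finally have sum: "g \<cdot> f = (g \<cdot> ?D) \<boxplus> (g \<cdot> f')" .
  have "g \<cdot> f \<in> Hom \<C> A C" "g \<cdot> f' \<in> Hom \<C> A C" "g \<cdot> ?D \<in> Hom \<C> A C"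
    using assms D by (auto intro: comp_in_hom[of A B C])
  then show ?thesis
    using hom_diff_eq_iff[of A C "g \<cdot> f" "g \<cdot> f'" "g \<cdot> ?D"] assms sum by auto
qed

lemma comp_hom_diff_left:
  assumes "A \<in> Obj \<C>" "B \<in> Obj \<C>" "C \<in> Obj \<C>"
    and "f \<in> Hom \<C> A B" "g \<in> Hom \<C> B C" "g' \<in> Hom \<C> B C"
  shows "hom_diff \<C> B C g g' \<cdot> f = hom_diff \<C> A C (g \<cdot> f) (g' \<cdot> f)"
proof -
  let ?D = "hom_diff \<C> B C g g'"
  have D: "?D \<in> Hom \<C> B C" using assms by (intro hom_diff_in_Hom)
  have "g \<cdot> f = (?D \<boxplus> g') \<cdot> f"
    using assms by (simp add: hom_diff_add_cancel)
  also have "\<dots> = (?D \<cdot> f) \<boxplus> (g' \<cdot> f)"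
    using assms D by (intro comp_add_left)
  finally have sum: "g \<cdot> f = (?D \<cdot> f) \<boxplus> (g' \<cdot> f)" .
  have "g \<cdot> f \<in> Hom \<C> A C" "g' \<cdot> f \<in> Hom \<C> A C" "?D \<cdot> f \<in> Hom \<C> A C"
    using assms D by (auto intro: comp_in_hom[of A B C])
  then show ?thesis
    using hom_diff_eq_iff[of A C "g \<cdot> f" "g' \<cdot> f" "?D \<cdot> f"] assms sum by auto
qed

lemma hom_diff_self:
  assumes "A \<in> Obj \<C>" "B \<in> Obj \<C>" "f \<in> Hom \<C> A B"
  shows "hom_diff \<C> A B f f = \<zero>\<^sub>m A B"
  using assms by (simp add: hom_diff_eq_iff MZero_in_Hom MSum_zero_left)

text \<open>Diagram chases use the short exact sequence through its elements: surjectivity gives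
  lifts along \<open>y\<close>, exactness in the middle gives factorizations through
  \<open>x\<close>, and injectivity lets \<open>x\<close> be cancelled.\<close>

lemma hom_from_exactD:
  assumes "hom_from_exact \<C> W A x B y C"
  shows hom_from_exact_lift: "h \<in> Hom \<C> W C \<Longrightarrow> \<exists>k \<in> Hom \<C> W B. y \<cdot> k = h"
    and hom_from_exact_factor:
      "\<lbrakk>h \<in> Hom \<C> W B; y \<cdot> h = \<zero>\<^sub>m W C\<rbrakk> \<Longrightarrow> \<exists>k \<in> Hom \<C> W A. x \<cdot> k = h"
    and hom_from_exact_mono:
      "\<lbrakk>h \<in> Hom \<C> W A; k \<in> Hom \<C> W A; x \<cdot> h = x \<cdot> k\<rbrakk> \<Longrightarrow> h = k"
proof -
  have ses: "inj_on (\<lambda>h. x \<cdot> h) (Hom \<C> W A)" "(\<lambda>h. y \<cdot> h) ` Hom \<C> W B = Hom \<C> W C"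
    "kernel (hom_group \<C> W B) (hom_group \<C> W C) (\<lambda>h. y \<cdot> h) = (\<lambda>h. x \<cdot> h) ` Hom \<C> W A"
    using assms by (auto simp: hom_from_exact_def short_exact_sequence_iff mon_def epi_def hom_group_def)
  show "h \<in> Hom \<C> W C \<Longrightarrow> \<exists>k \<in> Hom \<C> W B. y \<cdot> k = h"
    by (auto simp flip: ses(2))
  show "\<lbrakk>h \<in> Hom \<C> W B; y \<cdot> h = \<zero>\<^sub>m W C\<rbrakk> \<Longrightarrow> \<exists>k \<in> Hom \<C> W A. x \<cdot> k = h"
    using ses(3) by (force simp: kernel_def hom_group_def)
  show "\<lbrakk>h \<in> Hom \<C> W A; k \<in> Hom \<C> W A; x \<cdot> h = x \<cdot> k\<rbrakk> \<Longrightarrow> h = k"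
    using ses(1) by (auto dest: inj_onD)
qed

end


section \<open>The comparison theorem\<close>

text \<open>\<open>chain_cod A G n\<close> is the codomain of \<open>d n\<close>, so that \<open>d 0\<close> and \<open>d (n + 1)\<close> are treated alike.\<close>

definition chain_cod :: "'o \<Rightarrow> (nat \<Rightarrow> 'o) \<Rightarrow> nat \<Rightarrow> 'o"
  where "chain_cod A G n = (case n of 0 \<Rightarrow> A | Suc m \<Rightarrow> G m)"

lemma chain_cod_simps [simp]: "chain_cod A G 0 = A" "chain_cod A G (Suc n) = G n"
  by (simp_all add: chain_cod_def)

text \<open>The first clause is exactness at \<open>A\<close> after applying Hom from
  \<open>W\<close>, the second exactness at each \<open>G n\<close>. Only kernel in image is
  recorded; for an augmented complex the other inclusion follows from the vanishing of consecutive
  composites.\<close>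

definition complex_hom_from_exact ::
  "('o, 'm, 'z) cat_data_scheme \<Rightarrow> 'o \<Rightarrow> 'o \<Rightarrow> (nat \<Rightarrow> 'o) \<Rightarrow> (nat \<Rightarrow> 'm) \<Rightarrow> bool"
  where "complex_hom_from_exact \<C> W A G d \<longleftrightarrow>
    (\<forall>h \<in> Hom \<C> W A. \<exists>k \<in> Hom \<C> W (G 0). d 0 \<cdot> k = h) \<and>
    (\<forall>n. \<forall>h \<in> Hom \<C> W (G n). d n \<cdot> h = \<zero>\<^sub>m W (chain_cod A G n) \<longrightarrow>
      (\<exists>k \<in> Hom \<C> W (G (Suc n)). d (Suc n) \<cdot> k = h))"
  for \<C> (structure)

context additive_category
begin

lemma augmented_complexD:
  assumes "augmented_complex \<C> A G d"
  shows "A \<in> Obj \<C>" and "G n \<in> Obj \<C>" and "chain_cod A G n \<in> Obj \<C>"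
    and "d n \<in> Hom \<C> (G n) (chain_cod A G n)"
    and "d n \<cdot> d (Suc n) = \<zero>\<^sub>m (G (Suc n)) (chain_cod A G n)"
  using assms by (cases n; simp add: augmented_complex_def)+

lemma comparison_existence:
  assumes X: "augmented_complex \<C> A G d" and X': "augmented_complex \<C> A' G' d'"
    and f: "f \<in> Hom \<C> A A'"
    and exact: "\<And>n. complex_hom_from_exact \<C> (G n) A' G' d'"
  shows "\<exists>\<phi>. chain_map_lifting \<C> f G d G' d' \<phi>"
proof -
  note [simp] = augmented_complexD(1-3)[OF X] augmented_complexD(1-3)[OF X']
  have d: "d n \<in> Hom \<C> (G n) (chain_cod A G n)" for n by (rule augmented_complexD[OF X])
  have d': "d' n \<in> Hom \<C> (G' n) (chain_cod A' G' n)" for n by (rule augmented_complexD[OF X'])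
  note dS = d[of "Suc _", simplified] and dS' = d'[of "Suc _", simplified]
  have dd: "d n \<cdot> d (Suc n) = \<zero>\<^sub>m (G (Suc n)) (chain_cod A G n)" for n
    by (rule augmented_complexD[OF X])
  \<comment> \<open>The middle clause says that \<open>u \<cdot> d (Suc n)\<close> is a cycle, which
    is what the next lift requires. The last clause stores the condition in degree zero, since
    dependent choice only relates consecutive components.\<close>
  define P where "P n u \<longleftrightarrow> u \<in> Hom \<C> (G n) (G' n) \<and>
    d' n \<cdot> (u \<cdot> d (Suc n)) = \<zero>\<^sub>m (G (Suc n)) (chain_cod A' G' n) \<and>
    (n = 0 \<longrightarrow> d' 0 \<cdot> u = f \<cdot> d 0)" for n u
  have "\<exists>\<phi>. \<forall>n. P n (\<phi> n) \<and> d' (Suc n) \<cdot> \<phi> (Suc n) = \<phi> n \<cdot> d (Suc n)"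
  proof (rule dependent_nat_choice)
    have "f \<cdot> d 0 \<in> Hom \<C> (G 0) A'"
      using d[of 0] f by (auto intro: comp_in_hom[of _ A])
    then obtain u where u: "u \<in> Hom \<C> (G 0) (G' 0)" "d' 0 \<cdot> u = f \<cdot> d 0"
      using exact[of 0] unfolding complex_hom_from_exact_def by blast
    have "d' 0 \<cdot> (u \<cdot> d (Suc 0)) = (f \<cdot> d 0) \<cdot> d (Suc 0)"
      using u d'[of 0] dS by (simp flip: comp_assoc[of "G (Suc 0)" "G 0" "G' 0" A'])
    also have "\<dots> = f \<cdot> (d 0 \<cdot> d (Suc 0))"
      using d[of 0] f dS by (intro comp_assoc[of _ "G 0" A A']) auto
    also have "\<dots> = \<zero>\<^sub>m (G (Suc 0)) A'"
      using dd[of 0] f by (simp add: comp_zero_right)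
    finally show "\<exists>u. P 0 u" using u by (auto simp: P_def)
  next
    fix u n assume "P n u"
    then have u: "u \<in> Hom \<C> (G n) (G' n)"
      and z: "d' n \<cdot> (u \<cdot> d (Suc n)) = \<zero>\<^sub>m (G (Suc n)) (chain_cod A' G' n)"
      by (auto simp: P_def)
    have "u \<cdot> d (Suc n) \<in> Hom \<C> (G (Suc n)) (G' n)"
      using u dS by (auto intro: comp_in_hom[of _ "G n"])
    \<comment> \<open>Exactness at \<open>G' n\<close>, tested on \<open>W = G (Suc n)\<close>, is
      applied to the cycle \<open>u \<cdot> d (Suc n)\<close>.\<close>
    then obtain v where v: "v \<in> Hom \<C> (G (Suc n)) (G' (Suc n))" "d' (Suc n) \<cdot> v = u \<cdot> d (Suc n)"
      using exact[of "Suc n"] z unfolding complex_hom_from_exact_def by blast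
    \<comment> \<open>The new square moves the differential to the source complex, where two
      consecutive differentials compose to zero; this restores the invariant one degree
      higher.\<close>
    have "d' (Suc n) \<cdot> (v \<cdot> d (Suc (Suc n))) = (u \<cdot> d (Suc n)) \<cdot> d (Suc (Suc n))"
      using v dS dS'
      by (simp flip: comp_assoc[of "G (Suc (Suc n))" "G (Suc n)" "G' (Suc n)" "G' n"])
    also have "\<dots> = u \<cdot> (d (Suc n) \<cdot> d (Suc (Suc n)))"
      using u dS by (intro comp_assoc[of _ "G (Suc n)" "G n" "G' n"]) auto
    also have "\<dots> = \<zero>\<^sub>m (G (Suc (Suc n))) (G' n)"
      using dd[of "Suc n"] u by (simp add: comp_zero_right)
    finally show "\<exists>v. P (Suc n) v \<and> d' (Suc n) \<cdot> v = u \<cdot> d (Suc n)"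
      using v by (auto simp: P_def)
  qed
  then show ?thesis by (auto simp: P_def chain_map_lifting_def)
qed

text \<open>The difference \<open>e\<close> of the two lifts is a chain map over the zero morphism.
  Once \<open>s n\<close> is known, \<open>e (Suc n)\<close> minus
  \<open>s n \<cdot> d (Suc n)\<close> is a cycle, and exactness writes it as a boundary, which
  yields \<open>s (Suc n)\<close>.\<close>

lemma comparison_uniqueness:
  assumes X: "augmented_complex \<C> A G d" and X': "augmented_complex \<C> A' G' d'"
    and f: "f \<in> Hom \<C> A A'"
    and exact: "\<And>n. complex_hom_from_exact \<C> (G n) A' G' d'"
    and \<phi>: "chain_map_lifting \<C> f G d G' d' \<phi>" and \<psi>: "chain_map_lifting \<C> f G d G' d' \<psi>"
  shows "chain_homotopic \<C> G d G' d' \<phi> \<psi>"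
proof -
  note [simp] = augmented_complexD(1-3)[OF X] augmented_complexD(1-3)[OF X']
  have d: "d n \<in> Hom \<C> (G n) (chain_cod A G n)" for n by (rule augmented_complexD[OF X])
  have d': "d' n \<in> Hom \<C> (G' n) (chain_cod A' G' n)" for n by (rule augmented_complexD[OF X'])
  note dS = d[of "Suc _", simplified] and dS' = d'[of "Suc _", simplified]
  have dd: "d n \<cdot> d (Suc n) = \<zero>\<^sub>m (G (Suc n)) (chain_cod A G n)" for n
    by (rule augmented_complexD[OF X])
  have hom: "\<phi> n \<in> Hom \<C> (G n) (G' n)" "\<psi> n \<in> Hom \<C> (G n) (G' n)" for n
    using \<phi> \<psi> by (auto simp: chain_map_lifting_def)
  define e where "e n = hom_diff \<C> (G n) (G' n) (\<phi> n) (\<psi> n)" for n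
  have e: "e n \<in> Hom \<C> (G n) (G' n)" for n
    using hom by (simp add: e_def hom_diff_in_Hom)
  have e0: "d' 0 \<cdot> e 0 = \<zero>\<^sub>m (G 0) A'"
  proof -
    have "f \<cdot> d 0 \<in> Hom \<C> (G 0) A'"
      using d[of 0] f by (auto intro: comp_in_hom[of _ A])
    then show ?thesis
      using d'[of 0] hom \<phi> \<psi>
      by (simp add: e_def comp_hom_diff_right[of _ _ A'] hom_diff_self chain_map_lifting_def)
  qed
  have eS: "d' (Suc n) \<cdot> e (Suc n) = e n \<cdot> d (Suc n)" for n
    using dS'[of n] dS[of n] hom \<phi> \<psi>
    by (simp add: e_def comp_hom_diff_right[of _ _ "G' n"] comp_hom_diff_left[of "G (Suc n)"]
        chain_map_lifting_def)
  \<comment> \<open>The middle clause is the homotopy identity in degree \<open>n\<close> composed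
    with \<open>d (Suc n)\<close>. The term from the preceding component has dropped out there, so
    the invariant mentions a single component of the homotopy.\<close>
  define P where "P n s \<longleftrightarrow> s \<in> Hom \<C> (G n) (G' (Suc n)) \<and>
    (d' (Suc n) \<cdot> s) \<cdot> d (Suc n) = e n \<cdot> d (Suc n) \<and> (n = 0 \<longrightarrow> d' 1 \<cdot> s = e 0)" for n s
  have "\<exists>s. \<forall>n. P n (s n) \<and> e (Suc n) = (d' (Suc (Suc n)) \<cdot> s (Suc n)) \<boxplus> (s n \<cdot> d (Suc n))"
  proof (rule dependent_nat_choice)
    \<comment> \<open>\<open>e 0\<close> is a cycle, hence a boundary by exactness at
      \<open>G' 0\<close>; this matches the zero component of the homotopy on
      \<open>A\<close>.\<close>
    obtain s where "s \<in> Hom \<C> (G 0) (G' (Suc 0))" "d' (Suc 0) \<cdot> s = e 0"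
      using exact[of 0] e[of 0] e0 unfolding complex_hom_from_exact_def
      by (metis chain_cod_simps(1))
    then show "\<exists>s. P 0 s" by (auto simp: P_def)
  next
    fix s n assume "P n s"
    then have s: "s \<in> Hom \<C> (G n) (G' (Suc n))"
      and sd: "(d' (Suc n) \<cdot> s) \<cdot> d (Suc n) = e n \<cdot> d (Suc n)"
      by (auto simp: P_def)
    have s_d: "s \<cdot> d (Suc n) \<in> Hom \<C> (G (Suc n)) (G' (Suc n))"
      using s dS by (auto intro: comp_in_hom[of _ "G n"])
    have e_d: "e n \<cdot> d (Suc n) \<in> Hom \<C> (G (Suc n)) (G' n)"
      using e dS by (auto intro: comp_in_hom[of _ "G n"])
    \<comment> \<open>The part of \<open>e (Suc n)\<close> that the next component of the homotopy
      has to account for.\<close>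
    define r where "r = hom_diff \<C> (G (Suc n)) (G' (Suc n)) (e (Suc n)) (s \<cdot> d (Suc n))"
    have r: "r \<in> Hom \<C> (G (Suc n)) (G' (Suc n))"
      using e s_d by (simp add: r_def hom_diff_in_Hom)
    \<comment> \<open>By the invariant and the chain map property of \<open>e\<close>, both terms of
      \<open>r\<close> have the same image under \<open>d' (Suc n)\<close>, so \<open>r\<close> is a
      cycle.\<close>
    have "d' (Suc n) \<cdot> (s \<cdot> d (Suc n)) = e n \<cdot> d (Suc n)"
      using s dS dS' by (simp add: comp_assoc[of "G (Suc n)" "G n" "G' (Suc n)" "G' n"] flip: sd)
    then have "d' (Suc n) \<cdot> r = \<zero>\<^sub>m (G (Suc n)) (G' n)"
      using dS'[of n] e s_d e_d
      by (simp add: r_def comp_hom_diff_right[of _ _ "G' n"] eS hom_diff_self)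
    then obtain t where t: "t \<in> Hom \<C> (G (Suc n)) (G' (Suc (Suc n)))" "d' (Suc (Suc n)) \<cdot> t = r"
      using exact[of "Suc n"] r unfolding complex_hom_from_exact_def
      by (metis chain_cod_simps(2))
    have sum: "e (Suc n) = r \<boxplus> (s \<cdot> d (Suc n))"
      using e s_d by (simp add: r_def hom_diff_add_cancel)
    \<comment> \<open>To restore the invariant: \<open>r\<close> and \<open>e (Suc n)\<close> differ
      by a term that vanishes after composition with the next differential.\<close>
    have "(s \<cdot> d (Suc n)) \<cdot> d (Suc (Suc n)) = \<zero>\<^sub>m (G (Suc (Suc n))) (G' (Suc n))"
      using s dS dd[of "Suc n"]
      by (simp add: comp_assoc[of "G (Suc (Suc n))" "G (Suc n)" "G n" "G' (Suc n)"] comp_zero_right)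
    moreover have "e (Suc n) \<cdot> d (Suc (Suc n))
        = (r \<cdot> d (Suc (Suc n))) \<boxplus> ((s \<cdot> d (Suc n)) \<cdot> d (Suc (Suc n)))"
      using r s_d dS by (simp add: sum comp_add_left[of "G (Suc (Suc n))" "G (Suc n)" "G' (Suc n)"])
    moreover have "r \<cdot> d (Suc (Suc n)) \<in> Hom \<C> (G (Suc (Suc n))) (G' (Suc n))"
      using r dS by (auto intro: comp_in_hom[of _ "G (Suc n)"])
    ultimately have "r \<cdot> d (Suc (Suc n)) = e (Suc n) \<cdot> d (Suc (Suc n))"
      by (simp add: MSum_zero_right)
    then show "\<exists>t. P (Suc n) t \<and> e (Suc n) = (d' (Suc (Suc n)) \<cdot> t) \<boxplus> (s \<cdot> d (Suc n))"
      using t sum by (auto simp: P_def)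
  qed
  then show ?thesis by (auto simp: P_def chain_homotopic_def e_def)
qed

end

text \<open>Splicing: a cycle in degree \<open>n\<close> factors through \<open>K (Suc n)\<close> by
  exactness of one triangle, and the factor lifts along \<open>f (Suc n)\<close> by exactness of the
  next. The two maps involved compose to \<open>d (Suc n)\<close>.\<close>

lemma (in extriangulated_category) resolution_triangles_hom_from_exact:
  assumes R: "resolution_triangles \<C> \<xi> A G d K g f \<delta>"
    and W: "W \<in> Obj \<C>"
    and exact: "\<And>n. hom_from_exact \<C> W (K (Suc n)) (g n) (G n) (f n) (K n)"
  shows "complex_hom_from_exact \<C> W A G d"
proof -
  have K0: "K 0 = A" and d0: "d 0 = f 0" and dS: "d (Suc n) = g n \<cdot> f (Suc n)" for n
    using R by (auto simp: resolution_triangles_def)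
  have [simp]: "K n \<in> Obj \<C>" "G n \<in> Obj \<C>" for n
    using R by (auto simp: resolution_triangles_def xi_triangle_def etriangle_def)
  have gf: "g n \<in> Hom \<C> (K (Suc n)) (G n)" "f n \<in> Hom \<C> (G n) (K n)" for n
    using R by (auto simp: resolution_triangles_def xi_triangle_def etriangle_def)
  have dS_comp: "d (Suc n) \<cdot> h = g n \<cdot> (f (Suc n) \<cdot> h)" if "h \<in> Hom \<C> W (G (Suc n))" for n h
    using that W gf by (simp add: dS comp_assoc[of W "G (Suc n)" "K (Suc n)" "G n"])
  show ?thesis
    unfolding complex_hom_from_exact_def
  proof (intro conjI ballI allI impI)
    fix h assume "h \<in> Hom \<C> W A"
    then show "\<exists>k \<in> Hom \<C> W (G 0). d 0 \<cdot> k = h"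
      using hom_from_exact_lift[OF exact[of 0]] by (simp add: K0 d0)
  next
    fix n h assume h: "h \<in> Hom \<C> W (G n)" and z: "d n \<cdot> h = \<zero>\<^sub>m W (chain_cod A G n)"
    \<comment> \<open>In degree zero \<open>d 0\<close> is \<open>f 0\<close> itself. In higher
      degrees \<open>d n\<close> ends with the map \<open>g\<close> of the preceding triangle, which
      is cancellable on morphisms from \<open>W\<close>.\<close>
    have "f n \<cdot> h = \<zero>\<^sub>m W (K n)"
    proof (cases n)
      case 0
      then show ?thesis using z by (simp add: K0 d0)
    next
      case (Suc m)
      have "g m \<cdot> (f n \<cdot> h) = g m \<cdot> \<zero>\<^sub>m W (K n)"
        using z h W gf Suc by (simp add: dS_comp comp_zero_right[of W "K (Suc m)" "G m"])
      moreover have "f n \<cdot> h \<in> Hom \<C> W (K n)" "\<zero>\<^sub>m W (K n) \<in> Hom \<C> W (K n)"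
        using h W gf by (auto intro: comp_in_hom[of _ "G n"] MZero_in_Hom)
      ultimately show ?thesis
        using hom_from_exact_mono[OF exact[of m]] Suc by simp
    qed
    then obtain k where k: "k \<in> Hom \<C> W (K (Suc n))" "g n \<cdot> k = h"
      using hom_from_exact_factor[OF exact h] by blast
    obtain l where l: "l \<in> Hom \<C> W (G (Suc n))" "f (Suc n) \<cdot> l = k"
      using hom_from_exact_lift[OF exact k(1)] by blast
    show "\<exists>k \<in> Hom \<C> W (G (Suc n)). d (Suc n) \<cdot> k = h"
      using l k by (auto simp: dS_comp)
  qed
qed

theorem theorem3p6:
  fixes \<C> :: "('o, 'm, 'e, 'z) ext_data_scheme"
    and \<xi> :: "('m \<times> 'm \<times> 'e) set"
    and A A' :: 'o and f :: 'm
    and G G' :: "nat \<Rightarrow> 'o" and d d' :: "nat \<Rightarrow> 'm"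
  assumes "extriangulated_category \<C>"
    and "condition_WIC \<C>"
    and "proper_class \<C> \<xi>"
    and "enough_xi_projectives \<C> \<xi>"
    and "enough_xi_injectives \<C> \<xi>"
    and "A \<in> Obj \<C>" and "A' \<in> Obj \<C>" and "f \<in> Hom \<C> A A'"
    and "xi_Gprojective_resolution \<C> \<xi> A G d"
    and "proper_xi_Gprojective_resolution \<C> \<xi> A' G' d'"
  shows "(\<exists>\<phi>. chain_map_lifting \<C> f G d G' d' \<phi>) \<and>
    (\<forall>\<phi> \<psi>. chain_map_lifting \<C> f G d G' d' \<phi> \<longrightarrow> chain_map_lifting \<C> f G d G' d' \<psi> \<longrightarrow>
      chain_homotopic \<C> G d G' d' \<phi> \<psi>)"
proof -
  interpret extriangulated_category \<C> by fact
  from assms(9) have X: "augmented_complex \<C> A G d" and G: "\<And>n. G n \<in> xi_Gprojectives \<C> \<xi>"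
    by (auto simp: xi_Gprojective_resolution_def)
  from assms(10) obtain K g p \<delta> where X': "augmented_complex \<C> A' G' d'"
    and R: "resolution_triangles \<C> \<xi> A' G' d' K g p \<delta>"
    and proper: "\<And>n W. W \<in> xi_Gprojectives \<C> \<xi> \<Longrightarrow>
      hom_from_exact \<C> W (K (Suc n)) (g n) (G' n) (p n) (K n)"
    by (auto simp: proper_xi_Gprojective_resolution_def)
  \<comment> \<open>Properness of the second resolution is tested on the terms of the first, which
    are Gprojective; this is where the two resolutions meet.\<close>
  have exact: "complex_hom_from_exact \<C> (G n) A' G' d'" for n
    using augmented_complexD(2)[OF X] proper[OF G]
    by (rule resolution_triangles_hom_from_exact[OF R])
  show ?thesis
    using comparison_existence[OF X X' assms(8) exact]
      comparison_uniqueness[OF X X' assms(8) exact] by blast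
qed

end
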